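(* In the presence of priority rules, the asymptotic throughput of some transition, even one with highest level of priority, may be decreased by an increase of the resources. That is: there exist a fluid timed Petri net (graph, holding times, weights, preselection proportions) with compatible priority rules, a transition $q\in\mathcal{Q}_{\mathsf{prio}}$ which has the highest priority at every one of its upstream places ruled by priority, and two initial markings $m,m'\in(\mathbb{R}_{\ge0})^{\mathcal{P}}$ with $m_p\le m'_p$ for all $p\in\mathcal{P}$, such that the stationary throughputs of $q$ for the markings $m$ and $m'$ are well defined and the one for $m'$ is strictly smaller than the one for $m$.
   Context: A fluid timed Petri net consists of: two finite disjoint sets $\mathcal{P}$ (places) and $\mathcal{Q}$ (transitions); a directed bipartite graph on $\mathcal{P}\cup\mathcal{Q}$, where $x^{\mathrm{in}}$ (resp. $x^{\mathrm{out}}$) denotes the set of vertices $y$ with an arc from $y$ to $x$ (resp. from $x$ to $y$), and every transition has at least one upstream place; an initial marking $m_p\ge 0$ ("resources") and a holding time $\tau_p\ge 0$ for each place $p$; a weight $\alpha_{qp}>0$ for each arc from place $p$ to transition $q$, and a weight $\alpha_{pq}>0$ for each arc from transition $q$ to place $p$. Every place with several downstream transitions has a routing rule, either preselection or priority. A place $p$ ruled by preselection is equipped with a probability vector $(\pi_{qp})_{q\in p^{\mathrm{out}}}$, and each $q\in p^{\mathrm{out}}$ has $p$ as its only upstream place. A place $p$ ruled by priority is equipped with a total order $\prec_p$ on $p^{\mathrm{out}}$, where $q'\prec_p q$ means that $q'$ has higher priority than $q$ (equivalently $q\succ_p q'$); the rules are compatible, i.e. the union of the relations $\prec_p$ over all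 priority places is acyclic. $\mathcal{Q}_{\mathsf{psel}}$ (resp. $\mathcal{Q}_{\mathsf{prio}}$) is the set of downstream transitions of places ruled by preselection (resp. priority), and $\mathcal{Q}_{\mathsf{sync}}$ is the set of remaining transitions. If $q\in\mathcal{Q}_{\mathsf{prio}}$ has an upstream place $p$ not ruled by priority, then $p^{\mathrm{out}}=\{q\}$ and the sums over $q'\succ_p q$ and $q'\in p^{\mathrm{out}}\setminus\{q\}$ below are empty (zero). Stationary regimes for the marking $m$ are the pairs $(\rho,u)\in(\mathbb{R}_{\ge0})^{\mathcal{Q}}\times\mathbb{R}^{\mathcal{Q}}$ (representing counter functions with germ $\rho t+u$ at infinity) solving the germ equations $$(\rho_q,u_q)=\min_{p\in q^{\mathrm{in}}}{}^{\mathrm{lex}}\ \alpha_{qp}^{-1}\Big((0,m_p)+\sum_{q'\in p^{\mathrm{in}}}\alpha_{pq'}(\rho_{q'},u_{q'}-\rho_{q'}\tau_p)\Big)\quad(q\in\mathcal{Q}_{\mathsf{sync}}),$$ $$(\rho_q,u_q)=\pi_{qp}\alpha_{qp}^{-1}\Big((0,m_p)+\sum_{q'\in p^{\mathrm{in}}}\alpha_{pq'}(\rho_{q'},u_{q'}-\rho_{q'}\tau_p)\Big)\quad(q\in\mathcal{Q}_{\mathsf{psel}},\ q^{\mathrm{in}}=\{p\}),$$ $$(\rho_q,u_q)=\min_{\substack{p\in q^{\mathrm{in}}\\ \sum_{q'\succ_p q}\rho_{q'}=0}}{}^{\!\!\!\!\mathrm{lex}}\ \alpha_{qp}^{-1}\Big((0,m_p)+\sum_{q'\in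 p^{\mathrm{in}}}\alpha_{pq'}(\rho_{q'},u_{q'}-\rho_{q'}\tau_p)-\sum_{q'\in p^{\mathrm{out}}\setminus\{q\}}\alpha_{q'p}(\rho_{q'},u_{q'})\Big)\quad(q\in\mathcal{Q}_{\mathsf{prio}}),$$ where operations on pairs are coordinatewise and $\min^{\mathrm{lex}}$ is the minimum for the lexicographic order on $\mathbb{R}^2$ (first coordinate first), the minimum over the empty set being a greatest element $\top\notin\mathbb{R}^2$. The stationary throughput of $q$ for the marking $m$ is well defined if the germ equations for the marking $m$ admit at least one solution $(\rho,u)\in(\mathbb{R}_{\ge0})^{\mathcal{Q}}\times\mathbb{R}^{\mathcal{Q}}$ and all solutions $(\rho,u)\in(\mathbb{R}_{\ge0})^{\mathcal{Q}}\times\mathbb{R}^{\mathcal{Q}}$ of these equations have the same value of $\rho_q$; the stationary throughput of $q$ is then this value. *)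

theory Defs
  imports "HOL-Analysis.Product_Vector" "HOL-Library.Product_Lexorder"
begin

text \<open>
  Germs \<open>(\<rho>, u)\<close> live in \<open>real \<times> real\<close>: addition and scalar multiplication are coordinatewise
  (Product Vector), while the order, and hence \<^const>\<open>Min\<close>, is lexicographic (Product Lexorder).
  Do not add an import of all of HOL-Analysis, which would bring in the clashing
  componentwise order on pairs.
\<close>

text \<open>
  As in the usual notation for weights and proportions, the head of an arc comes first:
  \<open>weight N y x\<close> is the weight of the arc from \<open>x\<close> to \<open>y\<close>, and \<open>proportion N q p\<close> is the
  proportion of the place \<open>p\<close> routed to \<open>q\<close>. A pair \<open>(q', q) \<in> prec N p\<close> means that \<open>q'\<close> has
  higher priority than \<open>q\<close> at \<open>p\<close>. The marking is not part of the record since it varies.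
\<close>

record 'v petri_net =
  places :: "'v set"
  transitions :: "'v set"
  arcs :: "('v \<times> 'v) set"
  weight :: "'v \<Rightarrow> 'v \<Rightarrow> real"
  holding_time :: "'v \<Rightarrow> real"
  psel_places :: "'v set"
  prio_places :: "'v set"
  proportion :: "'v \<Rightarrow> 'v \<Rightarrow> real"
  prec :: "'v \<Rightarrow> ('v \<times> 'v) set"

definition upstream :: "'v petri_net \<Rightarrow> 'v \<Rightarrow> 'v set" where
  "upstream N x = {y. (y, x) \<in> arcs N}"

definition downstream :: "'v petri_net \<Rightarrow> 'v \<Rightarrow> 'v set" where
  "downstream N x = {y. (x, y) \<in> arcs N}"

definition Q_psel :: "'v petri_net \<Rightarrow> 'v set" where
  "Q_psel N = (\<Union>p\<in>psel_places N. downstream N p)"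

definition Q_prio :: "'v petri_net \<Rightarrow> 'v set" where
  "Q_prio N = (\<Union>p\<in>prio_places N. downstream N p)"

definition Q_sync :: "'v petri_net \<Rightarrow> 'v set" where
  "Q_sync N = transitions N - (Q_psel N \<union> Q_prio N)"

definition compatible_priorities :: "'v petri_net \<Rightarrow> bool" where
  "compatible_priorities N \<longleftrightarrow> acyclic (\<Union>p\<in>prio_places N. prec N p)"

text \<open>The places carrying a routing rule are exactly those with several downstream transitions.\<close>

definition fluid_timed_petri_net :: "'v petri_net \<Rightarrow> bool" where
  "fluid_timed_petri_net N \<longleftrightarrow>
     finite (places N) \<and> finite (transitions N) \<and> places N \<inter> transitions N = {} \<and>
     arcs N \<subseteq> places N \<times> transitions N \<union> transitions N \<times> places N \<and>
     (\<forall>q\<in>transitions N. upstream N q \<noteq> {}) \<and>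
     (\<forall>p\<in>places N. holding_time N p \<ge> 0) \<and>
     (\<forall>(x, y)\<in>arcs N. weight N y x > 0) \<and>
     psel_places N \<inter> prio_places N = {} \<and>
     psel_places N \<union> prio_places N = {p \<in> places N. card (downstream N p) \<ge> 2} \<and>
     (\<forall>p\<in>psel_places N.
        (\<forall>q\<in>downstream N p. proportion N q p \<ge> 0) \<and>
        (\<Sum>q\<in>downstream N p. proportion N q p) = 1 \<and>
        (\<forall>q\<in>downstream N p. upstream N q = {p})) \<and>
     (\<forall>p\<in>prio_places N.
        prec N p \<subseteq> downstream N p \<times> downstream N p \<and>
        strict_linear_order_on (downstream N p) (prec N p)) \<and>
     compatible_priorities N"

definition is_marking :: "'v petri_net \<Rightarrow> ('v \<Rightarrow> real) \<Rightarrow> bool" where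
  "is_marking N m \<longleftrightarrow> (\<forall>p\<in>places N. m p \<ge> 0)"

definition inflow ::
  "'v petri_net \<Rightarrow> ('v \<Rightarrow> real) \<Rightarrow> ('v \<Rightarrow> real) \<Rightarrow> ('v \<Rightarrow> real) \<Rightarrow> 'v \<Rightarrow> real \<times> real" where
  "inflow N m \<rho> u p =
     (0, m p) + (\<Sum>q'\<in>upstream N p. weight N p q' *\<^sub>R (\<rho> q', u q' - \<rho> q' * holding_time N p))"

text \<open>Only priority places have lower-priority transitions; \<open>prec N p\<close> is junk elsewhere.\<close>

definition lower_priority :: "'v petri_net \<Rightarrow> 'v \<Rightarrow> 'v \<Rightarrow> 'v set" where
  "lower_priority N p q =
     (if p \<in> prio_places N then {q' \<in> downstream N p. (q, q') \<in> prec N p} else {})"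

text \<open>\<^const>\<open>None\<close> plays the role of the greatest element, the minimum of the empty set.\<close>

definition lex_min :: "(real \<times> real) set \<Rightarrow> (real \<times> real) option" where
  "lex_min S = (if S = {} then None else Some (Min S))"

definition sync_equations ::
  "'v petri_net \<Rightarrow> ('v \<Rightarrow> real) \<Rightarrow> ('v \<Rightarrow> real) \<Rightarrow> ('v \<Rightarrow> real) \<Rightarrow> bool" where
  "sync_equations N m \<rho> u \<longleftrightarrow>
     (\<forall>q\<in>Q_sync N.
        Some (\<rho> q, u q) =
          lex_min ((\<lambda>p. inverse (weight N q p) *\<^sub>R inflow N m \<rho> u p) ` upstream N q))"

definition psel_equations ::
  "'v petri_net \<Rightarrow> ('v \<Rightarrow> real) \<Rightarrow> ('v \<Rightarrow> real) \<Rightarrow> ('v \<Rightarrow> real) \<Rightarrow> bool" where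
  "psel_equations N m \<rho> u \<longleftrightarrow>
     (\<forall>q\<in>Q_psel N. \<forall>p. upstream N q = {p} \<longrightarrow>
        (\<rho> q, u q) = (proportion N q p * inverse (weight N q p)) *\<^sub>R inflow N m \<rho> u p)"

definition prio_equations ::
  "'v petri_net \<Rightarrow> ('v \<Rightarrow> real) \<Rightarrow> ('v \<Rightarrow> real) \<Rightarrow> ('v \<Rightarrow> real) \<Rightarrow> bool" where
  "prio_equations N m \<rho> u \<longleftrightarrow>
     (\<forall>q\<in>Q_prio N.
        Some (\<rho> q, u q) =
          lex_min ((\<lambda>p. inverse (weight N q p) *\<^sub>R
              (inflow N m \<rho> u p - (\<Sum>q'\<in>downstream N p - {q}. weight N q' p *\<^sub>R (\<rho> q', u q'))))
            ` {p \<in> upstream N q. (\<Sum>q'\<in>lower_priority N p q. \<rho> q') = 0}))"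

text \<open>Only the values of \<open>\<rho>\<close> and \<open>u\<close> on transitions are relevant.\<close>

definition stationary_regime ::
  "'v petri_net \<Rightarrow> ('v \<Rightarrow> real) \<Rightarrow> ('v \<Rightarrow> real) \<Rightarrow> ('v \<Rightarrow> real) \<Rightarrow> bool" where
  "stationary_regime N m \<rho> u \<longleftrightarrow>
     (\<forall>q\<in>transitions N. \<rho> q \<ge> 0) \<and>
     sync_equations N m \<rho> u \<and> psel_equations N m \<rho> u \<and> prio_equations N m \<rho> u"

definition throughput_well_defined :: "'v petri_net \<Rightarrow> ('v \<Rightarrow> real) \<Rightarrow> 'v \<Rightarrow> bool" where
  "throughput_well_defined N m q \<longleftrightarrow>
     (\<exists>\<rho> u. stationary_regime N m \<rho> u) \<and>
     (\<forall>\<rho> u \<rho>' u'. stationary_regime N m \<rho> u \<and> stationary_regime N m \<rho>' u' \<longrightarrow> \<rho> q = \<rho>' q)"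

text \<open>Meaningful only under \<^const>\<open>throughput_well_defined\<close>.\<close>

definition stationary_throughput :: "'v petri_net \<Rightarrow> ('v \<Rightarrow> real) \<Rightarrow> 'v \<Rightarrow> real" where
  "stationary_throughput N m q = (THE r. \<exists>\<rho> u. stationary_regime N m \<rho> u \<and> \<rho> q = r)"

definition highest_priority :: "'v petri_net \<Rightarrow> 'v \<Rightarrow> bool" where
  "highest_priority N q \<longleftrightarrow>
     (\<forall>p\<in>upstream N q \<inter> prio_places N. \<forall>q'\<in>downstream N p - {q}. (q, q') \<in> prec N p)"

end

theory Submission
  imports Defs
begin

text \<open>
  The net has a single priority place, a pool holding one token that each of three transitions
  takes and gives back after one unit of time; their throughputs therefore sum to one. The
  transition \<open>top_trans\<close> has the highest priority, but it also consumes the output of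
  \<open>low_trans\<close>, the one of lowest priority, so it cannot run faster than \<open>low_trans\<close>. The
  transition \<open>mid_trans\<close>, which overtakes \<open>low_trans\<close> at the pool, is regulated by a private
  loop of \<open>x\<close> tokens with unit holding time, so it runs at rate \<open>x\<close>. The remaining capacity
  \<open>1 - x\<close> is shared equally by \<open>low_trans\<close> and \<open>top_trans\<close>: the throughput of \<open>top_trans\<close> is
  \<open>(1 - x) / 2\<close>, decreasing in the resource \<open>x\<close>. An extra resource speeds up a transition of
  intermediate priority, which starves the lowest one, and with it the highest one that waits
  for its output.

  The lemma \<open>stationary_regime_iff\<close> makes the germ equations of this net explicit, and
  \<open>throughput_top\<close> solves them for every \<open>x\<close> between 0 and 1; the theorem compares \<open>x = 0\<close> with
  \<open>x = 1\<close>.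
\<close>

abbreviation "pool \<equiv> 10 :: nat"
abbreviation "loop \<equiv> 11 :: nat"
abbreviation "link \<equiv> 12 :: nat"
abbreviation "top_trans \<equiv> 20 :: nat"
abbreviation "mid_trans \<equiv> 21 :: nat"
abbreviation "low_trans \<equiv> 22 :: nat"

definition starving_net :: "nat petri_net" where
  "starving_net =
     \<lparr>places = {pool, loop, link},
      transitions = {top_trans, mid_trans, low_trans},
      arcs = {(pool, top_trans), (pool, mid_trans), (pool, low_trans),
              (top_trans, pool), (mid_trans, pool), (low_trans, pool),
              (loop, mid_trans), (mid_trans, loop),
              (low_trans, link), (link, top_trans)},
      weight = (\<lambda>_ _. 1),
      holding_time = (\<lambda>p. if p = link then 0 else 1),
      psel_places = {},
      prio_places = {pool},
      proportion = (\<lambda>_ _. 0),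
      prec = (\<lambda>_. {(top_trans, mid_trans), (top_trans, low_trans), (mid_trans, low_trans)})\<rparr>"

definition loop_marking :: "real \<Rightarrow> nat \<Rightarrow> real" where
  "loop_marking x p = (if p = pool then 1 else if p = loop then x else 0)"

lemma starving_net_fields:
  "places starving_net = {pool, loop, link}"
  "transitions starving_net = {top_trans, mid_trans, low_trans}"
  "weight starving_net y z = 1"
  "holding_time starving_net p = (if p = link then 0 else 1)"
  "psel_places starving_net = {}"
  "prio_places starving_net = {pool}"
  "prec starving_net p =
     {(top_trans, mid_trans), (top_trans, low_trans), (mid_trans, low_trans)}"
  by (simp_all add: starving_net_def)

lemma upstream_starving_net:
  "upstream starving_net pool = {top_trans, mid_trans, low_trans}"
  "upstream starving_net loop = {mid_trans}"
  "upstream starving_net link = {low_trans}"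
  "upstream starving_net top_trans = {pool, link}"
  "upstream starving_net mid_trans = {pool, loop}"
  "upstream starving_net low_trans = {pool}"
  by (auto simp: upstream_def starving_net_def)

lemma downstream_starving_net:
  "downstream starving_net pool = {top_trans, mid_trans, low_trans}"
  "downstream starving_net loop = {mid_trans}"
  "downstream starving_net link = {top_trans}"
  by (auto simp: downstream_def starving_net_def)

lemma lower_priority_starving_net:
  "lower_priority starving_net pool top_trans = {mid_trans, low_trans}"
  "lower_priority starving_net pool mid_trans = {low_trans}"
  "lower_priority starving_net pool low_trans = {}"
  "p \<noteq> pool \<Longrightarrow> lower_priority starving_net p q = {}"
  by (auto simp: lower_priority_def downstream_starving_net starving_net_fields)

lemma transitions_starving_net_by_rule:
  "Q_psel starving_net = {}"
  "Q_prio starving_net = {top_trans, mid_trans, low_trans}"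
  "Q_sync starving_net = {}"
  by (auto simp: Q_psel_def Q_prio_def Q_sync_def downstream_starving_net starving_net_fields)

lemma fluid_timed_petri_net_starving_net: "fluid_timed_petri_net starving_net"
proof -
  have "wf {(top_trans, mid_trans), (top_trans, low_trans), (mid_trans, low_trans)}"
    by (rule wf_subset[OF wf_less_than]) auto
  then have "compatible_priorities starving_net"
    by (simp add: compatible_priorities_def starving_net_fields wf_acyclic)
  moreover have "prio_places starving_net
      = {p \<in> places starving_net. card (downstream starving_net p) \<ge> 2}"
    by (auto simp: starving_net_fields downstream_starving_net)
  moreover have "arcs starving_net \<subseteq>
      places starving_net \<times> transitions starving_net \<union> transitions starving_net \<times> places starving_net"
    by (simp add: starving_net_def)
  moreover have "strict_linear_order_on (downstream starving_net pool) (prec starving_net pool)"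
    by (auto simp: strict_linear_order_on_def trans_def irrefl_def total_on_def
        starving_net_fields downstream_starving_net)
  ultimately show ?thesis
    by (auto simp: fluid_timed_petri_net_def starving_net_fields upstream_starving_net
        downstream_starving_net)
qed

lemma lex_min_singleton: "lex_min {g} = Some g"
  by (simp add: lex_min_def)

lemma Some_eq_lex_min_pair_iff: "Some g = lex_min {g, h} \<longleftrightarrow> g \<le> h"
  by (auto simp: lex_min_def min_def)

lemma inflow_starving_net:
  "inflow starving_net (loop_marking x) \<rho> u pool =
     (\<rho> top_trans + \<rho> mid_trans + \<rho> low_trans,
      u top_trans + u mid_trans + u low_trans
        + (1 - (\<rho> top_trans + \<rho> mid_trans + \<rho> low_trans)))"
  "inflow starving_net (loop_marking x) \<rho> u loop =
     (\<rho> mid_trans, u mid_trans + (x - \<rho> mid_trans))"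
  "inflow starving_net (loop_marking x) \<rho> u link = (\<rho> low_trans, u low_trans)"
  by (simp_all add: inflow_def upstream_starving_net starving_net_fields loop_marking_def)

text \<open>
  The tokens taken from the pool all return to it, so the pool offers to each transition its own
  germ, shifted by the number of tokens in excess of the total throughput. The transition of
  lowest priority is fed by the pool alone; its equation makes this shift vanish, after which the
  pool constrains the other two only by comparing their other upstream place with their own germ.
\<close>

lemma stationary_regime_iff:
  "stationary_regime starving_net (loop_marking x) \<rho> u \<longleftrightarrow>
     \<rho> top_trans \<ge> 0 \<and> \<rho> mid_trans \<ge> 0 \<and> \<rho> low_trans \<ge> 0 \<and>
     \<rho> top_trans + \<rho> mid_trans + \<rho> low_trans = 1 \<and>
     (if \<rho> mid_trans + \<rho> low_trans = 0
      then (\<rho> top_trans, u top_trans) \<le> (\<rho> low_trans, u low_trans)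
      else (\<rho> top_trans, u top_trans) = (\<rho> low_trans, u low_trans)) \<and>
     (if \<rho> low_trans = 0 then \<rho> mid_trans \<le> x else \<rho> mid_trans = x)"
proof -
  let ?germ = "\<lambda>q. (\<rho> q, u q)"
  let ?offer = "\<lambda>q p. inverse (weight starving_net q p) *\<^sub>R
      (inflow starving_net (loop_marking x) \<rho> u p
        - (\<Sum>q'\<in>downstream starving_net p - {q}. weight starving_net q' p *\<^sub>R ?germ q'))"
  let ?limiting = "\<lambda>q. {p \<in> upstream starving_net q.
      (\<Sum>q'\<in>lower_priority starving_net p q. \<rho> q') = 0}"
  let ?shift = "1 - (\<rho> top_trans + \<rho> mid_trans + \<rho> low_trans)"

  have offers:
    "?offer top_trans pool = (\<rho> top_trans, u top_trans + ?shift)"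
    "?offer mid_trans pool = (\<rho> mid_trans, u mid_trans + ?shift)"
    "?offer low_trans pool = (\<rho> low_trans, u low_trans + ?shift)"
    "?offer mid_trans loop = (\<rho> mid_trans, u mid_trans + (x - \<rho> mid_trans))"
    "?offer top_trans link = ?germ low_trans"
    by (simp_all add: inflow_starving_net downstream_starving_net starving_net_fields
        insert_Diff_if)
  have limiting:
    "?limiting top_trans = (if \<rho> mid_trans + \<rho> low_trans = 0 then {pool, link} else {link})"
    "?limiting mid_trans = (if \<rho> low_trans = 0 then {pool, loop} else {loop})"
    "?limiting low_trans = {pool}"
    by (auto simp: upstream_starving_net lower_priority_starving_net)
  have low: "Some (?germ low_trans) = lex_min (?offer low_trans ` ?limiting low_trans)
      \<longleftrightarrow> ?shift = 0"
    by (simp only: offers limiting image_insert image_empty lex_min_singleton) auto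
  have top: "Some (?germ top_trans) = lex_min (?offer top_trans ` ?limiting top_trans)
      \<longleftrightarrow> (if \<rho> mid_trans + \<rho> low_trans = 0 then ?germ top_trans \<le> ?germ low_trans
           else ?germ top_trans = ?germ low_trans)" if "?shift = 0"
    by (simp only: offers limiting that image_insert image_empty if_distrib[of "image _"]
        lex_min_singleton Some_eq_lex_min_pair_iff add_0_right option.inject split: if_split) simp
  have mid: "Some (?germ mid_trans) = lex_min (?offer mid_trans ` ?limiting mid_trans)
      \<longleftrightarrow> (if \<rho> low_trans = 0 then \<rho> mid_trans \<le> x else \<rho> mid_trans = x)" if "?shift = 0"
    by (simp only: offers limiting that image_insert image_empty if_distrib[of "image _"]
        lex_min_singleton Some_eq_lex_min_pair_iff add_0_right option.inject split: if_split)
      auto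
  have "stationary_regime starving_net (loop_marking x) \<rho> u \<longleftrightarrow>
      (\<forall>q\<in>transitions starving_net. \<rho> q \<ge> 0) \<and>
      (\<forall>q\<in>{top_trans, mid_trans, low_trans}.
         Some (?germ q) = lex_min (?offer q ` ?limiting q))"
    by (simp only: stationary_regime_def sync_equations_def psel_equations_def
        prio_equations_def transitions_starving_net_by_rule) simp
  also have "\<dots> \<longleftrightarrow>
      \<rho> top_trans \<ge> 0 \<and> \<rho> mid_trans \<ge> 0 \<and> \<rho> low_trans \<ge> 0 \<and> ?shift = 0 \<and>
      Some (?germ top_trans) = lex_min (?offer top_trans ` ?limiting top_trans) \<and>
      Some (?germ mid_trans) = lex_min (?offer mid_trans ` ?limiting mid_trans)"
    using low by (simp only: starving_net_fields(2) ball_simps) blast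
  also have "\<dots> \<longleftrightarrow>
      \<rho> top_trans \<ge> 0 \<and> \<rho> mid_trans \<ge> 0 \<and> \<rho> low_trans \<ge> 0 \<and> ?shift = 0 \<and>
      (if \<rho> mid_trans + \<rho> low_trans = 0 then ?germ top_trans \<le> ?germ low_trans
       else ?germ top_trans = ?germ low_trans) \<and>
      (if \<rho> low_trans = 0 then \<rho> mid_trans \<le> x else \<rho> mid_trans = x)"
    using top mid by blast
  also have "?shift = 0 \<longleftrightarrow> \<rho> top_trans + \<rho> mid_trans + \<rho> low_trans = 1"
    by auto
  finally show ?thesis .
qed

lemma stationary_regime_exists:
  assumes "0 \<le> x" "x \<le> 1"
  shows "\<exists>\<rho> u. stationary_regime starving_net (loop_marking x) \<rho> u"
proof (intro exI)
  show "stationary_regime starving_net (loop_marking x)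
      (\<lambda>q. if q = mid_trans then x else (1 - x) / 2) (\<lambda>_. 0)"
    using assms by (simp add: stationary_regime_iff field_simps)
qed

text \<open>
  If \<open>low_trans\<close> is active, then \<open>mid_trans\<close> is limited by its loop and \<open>top_trans\<close> by
  \<open>low_trans\<close>. Otherwise \<open>top_trans\<close> is starved, so \<open>mid_trans\<close> takes the whole capacity of
  the pool, which forces \<open>x = 1\<close>.
\<close>

lemma stationary_regime_top:
  assumes "x \<le> 1" and "stationary_regime starving_net (loop_marking x) \<rho> u"
  shows "\<rho> top_trans = (1 - x) / 2"
  using assms by (auto simp: stationary_regime_iff split: if_splits)

lemma throughput_top:
  assumes "0 \<le> x" "x \<le> 1"
  shows "throughput_well_defined starving_net (loop_marking x) top_trans"
    and "stationary_throughput starving_net (loop_marking x) top_trans = (1 - x) / 2"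
proof -
  note ex = stationary_regime_exists[OF assms]
  note top = stationary_regime_top[OF assms(2)]
  show "throughput_well_defined starving_net (loop_marking x) top_trans"
    using ex top unfolding throughput_well_defined_def by metis
  show "stationary_throughput starving_net (loop_marking x) top_trans = (1 - x) / 2"
    unfolding stationary_throughput_def using ex top by (intro the_equality) metis+
qed

theorem mainTheorem8:
  shows "\<exists>(N :: nat petri_net) q m m'.
           fluid_timed_petri_net N \<and>
           q \<in> Q_prio N \<and> highest_priority N q \<and>
           is_marking N m \<and> is_marking N m' \<and> (\<forall>p\<in>places N. m p \<le> m' p) \<and>
           throughput_well_defined N m q \<and> throughput_well_defined N m' q \<and>
           stationary_throughput N m' q < stationary_throughput N m q"
proof (intro exI conjI)
  show "fluid_timed_petri_net starving_net"
    by (rule fluid_timed_petri_net_starving_net)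
  show "top_trans \<in> Q_prio starving_net"
    by (simp add: transitions_starving_net_by_rule)
  show "highest_priority starving_net top_trans"
    by (auto simp: highest_priority_def upstream_starving_net downstream_starving_net
        starving_net_fields)
  show "is_marking starving_net (loop_marking 0)" "is_marking starving_net (loop_marking 1)"
    "\<forall>p\<in>places starving_net. loop_marking 0 p \<le> loop_marking 1 p"
    by (auto simp: is_marking_def loop_marking_def)
  show "throughput_well_defined starving_net (loop_marking 0) top_trans"
    "throughput_well_defined starving_net (loop_marking 1) top_trans"
    by (simp_all add: throughput_top)
  show "stationary_throughput starving_net (loop_marking 1) top_trans
      < stationary_throughput starving_net (loop_marking 0) top_trans"
    by (simp add: throughput_top)
qed

end
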